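(* Let $m,n,k$ be positive integers, $X\in\mathbb{R}^{m\times n}$, and $J(W,S)=\tfrac12\|X-WS\|_F^2$ on $\mathbb{R}^{m\times k}\times\mathbb{R}^{k\times n}$. Let $\mathcal{M}_0=\{(W,S):W^TW=SS^T\}$. Then there exists $\gamma<0$ such that $\lambda_{\min}(\nabla^2J(W,S))<\gamma$ for every strict saddle $(W,S)$ of $J$ with $(W,S)\in\mathcal{M}_0$.
   Context: $\mathbb{R}^{m\times k}\times\mathbb{R}^{k\times n}$ carries the inner product $\langle (G,H),(G',H')\rangle=\mathrm{trace}(G^TG')+\mathrm{trace}(H^TH')$. With $E=WS-X$, $\nabla J(W,S)=(ES^T,W^TE)$ and the Hessian map is the self-adjoint linear map $\nabla^2J(W,S)[(G,H)]=(GSS^T+WHS^T+EH^T,\ W^TWH+W^TGS+G^TE)$; $\lambda_{\min}$ is its smallest eigenvalue. A strict saddle is a point with $\nabla J=0$ and $\lambda_{\min}(\nabla^2J)<0$. *)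

theory Defs
  imports "HOL-Analysis.Analysis"
begin

text \<open>
  A matrix in \<open>\<real>\<^bsup>m \<times> n\<^esup>\<close> is an element of \<^typ>\<open>real ^ 'n ^ 'm\<close>; the library norm on this
  type is the Frobenius norm, and the library inner product on
  \<^typ>\<open>(real ^ 'k ^ 'm) \<times> (real ^ 'n ^ 'k)\<close> is the sum of the two trace inner products
  (lemma \<open>inner_matrix_pair_eq_trace\<close>).
\<close>

definition gradient :: "('a::real_inner \<Rightarrow> real) \<Rightarrow> 'a \<Rightarrow> 'a"
  where "gradient f x = (THE D. GDERIV f x :> D)"

definition hessian :: "('a::real_inner \<Rightarrow> real) \<Rightarrow> 'a \<Rightarrow> 'a \<Rightarrow> 'a"
  where "hessian f x = frechet_derivative (gradient f) (at x)"

definition eigenvalues :: "('a::real_vector \<Rightarrow> 'a) \<Rightarrow> real set"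
  where "eigenvalues L = {l. \<exists>v. v \<noteq> 0 \<and> L v = l *\<^sub>R v}"

text \<open>Meaningful for self-adjoint maps: see \<open>lambda_min_self_adjoint\<close>.\<close>

definition lambda_min :: "('a::real_vector \<Rightarrow> 'a) \<Rightarrow> real"
  where "lambda_min L = Min (eigenvalues L)"

definition strict_saddle :: "('a::real_inner \<Rightarrow> real) \<Rightarrow> 'a \<Rightarrow> bool"
  where "strict_saddle f x \<longleftrightarrow> gradient f x = 0 \<and> lambda_min (hessian f x) < 0"

definition J :: "real ^ 'n ^ 'm \<Rightarrow> (real ^ 'k ^ 'm) \<times> (real ^ 'n ^ 'k) \<Rightarrow> real"
  where "J X = (\<lambda>(W, S). (1 / 2) * (norm (X - W ** S))\<^sup>2)"

definition M0 :: "((real ^ 'k ^ 'm) \<times> (real ^ 'n ^ 'k)) set"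
  where "M0 = {(W, S). transpose W ** W = S ** transpose S}"

lemma inner_matrix_eq_trace:
  fixes G G' :: "real ^ 'b ^ 'a"
  shows "inner G G' = trace (transpose G ** G')"
proof -
  have "inner G G' = (\<Sum>i\<in>UNIV. \<Sum>j\<in>UNIV. G $ i $ j * G' $ i $ j)"
    by (simp add: inner_vec_def)
  also have "\<dots> = (\<Sum>j\<in>UNIV. \<Sum>i\<in>UNIV. G $ i $ j * G' $ i $ j)"
    by (rule sum.swap)
  finally show ?thesis
    by (simp add: trace_def matrix_matrix_mult_def transpose_def)
qed

lemma inner_matrix_pair_eq_trace:
  fixes G G' :: "real ^ 'k ^ 'm" and H H' :: "real ^ 'n ^ 'k"
  shows "inner (G, H) (G', H') = trace (transpose G ** G') + trace (transpose H ** H')"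
  by (simp add: inner_matrix_eq_trace)

lemma gradient_eqI:
  assumes "GDERIV f x :> D"
  shows "gradient f x = D"
proof -
  have "D' = D" if "GDERIV f x :> D'" for D'
  proof -
    have "(\<lambda>h. inner h D') = (\<lambda>h. inner h D)"
      using that assms unfolding gderiv_def by (rule has_derivative_unique)
    then show ?thesis
      by (simp add: fun_eq_iff vector_eq_ldot)
  qed
  then show ?thesis
    unfolding gradient_def by (intro the_equality assms)
qed

lemma matrix_mult_simps_bilinear:
  fixes A A' :: "real ^ 'b ^ 'a" and B :: "real ^ 'c ^ 'b"
  shows "(c *\<^sub>R A) ** B = c *\<^sub>R (A ** B)" "A ** (c *\<^sub>R B) = c *\<^sub>R (A ** B)"
    and "(A + A') ** B = A ** B + A' ** B"
  by (simp_all add: matrix_matrix_mult_def vec_eq_iff sum_distrib_left sum.distrib distrib_right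
      mult.assoc mult.left_commute[of _ c])

lemma bounded_bilinear_matrix_mult:
  "bounded_bilinear ((**) :: real ^ 'b ^ 'a \<Rightarrow> real ^ 'c ^ 'b \<Rightarrow> real ^ 'c ^ 'a)"
  unfolding bilinear_conv_bounded_bilinear[symmetric] bilinear_def
  by (intro conjI allI linearI matrix_mult_simps_bilinear matrix_add_ldistrib)

lemma bounded_linear_transpose:
  "bounded_linear (transpose :: real ^ 'b ^ 'a \<Rightarrow> real ^ 'a ^ 'b)"
  unfolding linear_conv_bounded_linear[symmetric]
  by (intro linearI) (simp_all add: transpose_def vec_eq_iff)

lemmas matrix_mult_derivative = bounded_bilinear.FDERIV[OF bounded_bilinear_matrix_mult]
lemmas transpose_derivative = bounded_linear.has_derivative[OF bounded_linear_transpose]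

lemma inner_matrix_mult_adjoint:
  fixes A :: "real ^ 'b ^ 'a" and B :: "real ^ 'c ^ 'b" and C :: "real ^ 'c ^ 'a"
  shows "inner (A ** B) C = inner A (C ** transpose B)"
    and "inner (A ** B) C = inner B (transpose A ** C)"
proof -
  have 1: "inner (A ** B) C = (\<Sum>i\<in>UNIV. \<Sum>j\<in>UNIV. \<Sum>l\<in>UNIV. A $ i $ l * B $ l $ j * C $ i $ j)"
    by (simp add: inner_vec_def matrix_matrix_mult_def sum_distrib_right)
  have "\<dots> = (\<Sum>i\<in>UNIV. \<Sum>l\<in>UNIV. \<Sum>j\<in>UNIV. A $ i $ l * B $ l $ j * C $ i $ j)"
    by (intro sum.cong refl sum.swap)
  also have "\<dots> = inner A (C ** transpose B)"
    by (simp add: inner_vec_def matrix_matrix_mult_def transpose_def sum_distrib_left mult_ac)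
  finally show "inner (A ** B) C = inner A (C ** transpose B)"
    using 1 by simp
  show "inner (A ** B) C = inner B (transpose A ** C)"
    by (simp add: inner_matrix_eq_trace matrix_transpose_mul matrix_mul_assoc)
qed

lemma gderiv_J:
  fixes X :: "real ^ 'n ^ 'm" and W :: "real ^ 'k ^ 'm" and S :: "real ^ 'n ^ 'k"
  shows "GDERIV (J X) (W, S) :>
    ((W ** S - X) ** transpose S, transpose W ** (W ** S - X))"
proof -
  have J_eq: "J X = (\<lambda>z. (1 / 2) * inner (X - fst z ** snd z) (X - fst z ** snd z))"
    by (auto simp: J_def fun_eq_iff power2_norm_eq_inner)
  have "(J X has_derivative (\<lambda>h. - inner (W ** snd h + fst h ** S) (X - W ** S))) (at (W, S))"
    unfolding J_eq
    by (rule derivative_eq_intros matrix_mult_derivative refl)+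
       (simp add: inner_commute fun_eq_iff inner_diff_left inner_add_left inner_diff_right inner_add_right)
  moreover have "- inner (W ** snd h + fst h ** S) (X - W ** S) =
      inner h ((W ** S - X) ** transpose S, transpose W ** (W ** S - X))"
    for h :: "(real ^ 'k ^ 'm) \<times> (real ^ 'n ^ 'k)"
  proof -
    have "- inner (W ** snd h + fst h ** S) (X - W ** S) =
        inner (W ** snd h) (W ** S - X) + inner (fst h ** S) (W ** S - X)"
      by (simp add: inner_add_left inner_diff_right)
    also have "\<dots> = inner (snd h) (transpose W ** (W ** S - X)) +
        inner (fst h) ((W ** S - X) ** transpose S)"
      by (simp add: inner_matrix_mult_adjoint(2)[of W] inner_matrix_mult_adjoint(1)[of "fst h"])
    finally show ?thesis
      by (simp add: inner_prod_def)
  qed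
  ultimately show ?thesis
    unfolding gderiv_def by simp
qed

lemma gradient_J:
  fixes X :: "real ^ 'n ^ 'm" and W :: "real ^ 'k ^ 'm" and S :: "real ^ 'n ^ 'k"
  shows "gradient (J X) (W, S) =
    ((W ** S - X) ** transpose S, transpose W ** (W ** S - X))"
  by (rule gradient_eqI[OF gderiv_J])

lemma hessian_J:
  fixes X :: "real ^ 'n ^ 'm" and W G :: "real ^ 'k ^ 'm" and S H :: "real ^ 'n ^ 'k"
  defines "E \<equiv> W ** S - X"
  shows "hessian (J X) (W, S) (G, H) =
    (G ** S ** transpose S + W ** H ** transpose S + E ** transpose H,
     transpose W ** W ** H + transpose W ** G ** S + transpose G ** E)"
proof -
  have grad: "gradient (J X) = (\<lambda>z. ((fst z ** snd z - X) ** transpose (snd z),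
      transpose (fst z) ** (fst z ** snd z - X)))"
    by (auto simp: fun_eq_iff gradient_J)
  have "(gradient (J X) has_derivative
      (\<lambda>h. ((W ** S - X) ** transpose (snd h) + (W ** snd h + fst h ** S) ** transpose S,
            transpose W ** (W ** snd h + fst h ** S) + transpose (fst h) ** (W ** S - X)))) (at (W, S))"
    unfolding grad
    by (rule derivative_eq_intros matrix_mult_derivative transpose_derivative refl)+ simp
  then have "hessian (J X) (W, S) =
      (\<lambda>h. ((W ** S - X) ** transpose (snd h) + (W ** snd h + fst h ** S) ** transpose S,
            transpose W ** (W ** snd h + fst h ** S) + transpose (fst h) ** (W ** S - X)))"
    unfolding hessian_def by (rule frechet_derivative_at[symmetric])
  then show ?thesis
    by (simp add: E_def matrix_add_ldistrib matrix_mul_assoc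
        bounded_bilinear.add_left[OF bounded_bilinear_matrix_mult] add_ac)
qed

lemma hessian_J_self_adjoint:
  fixes X :: "real ^ 'n ^ 'm" and z u v :: "(real ^ 'k ^ 'm) \<times> (real ^ 'n ^ 'k)"
  shows "linear (hessian (J X) z)"
    and "inner (hessian (J X) z u) v = inner u (hessian (J X) z v)"
proof -
  note bb = bounded_bilinear_matrix_mult
  note bl = bounded_linear_transpose
  obtain W S where z: "z = (W, S)" by (cases z)
  show "linear (hessian (J X) z)"
    unfolding z
    by (rule linearI)
       (auto simp: hessian_J bounded_bilinear.add_left[OF bb] bounded_bilinear.add_right[OF bb]
         bounded_linear.linear[OF bl, THEN linear_add] bounded_linear.linear[OF bl, THEN linear_scale]
         matrix_mult_simps_bilinear scaleR_add_right)
  obtain G H G' H' where u: "u = (G, H)" and v: "v = (G', H')" by (cases u, cases v)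
  define E where "E = W ** S - X"
  have form: "inner (hessian (J X) (W, S) (A, B)) (C, D) =
      inner (A ** S + W ** B) (C ** S + W ** D) + inner E (C ** B) + inner E (A ** D)"
    for A C :: "real ^ 'k ^ 'm" and B D :: "real ^ 'n ^ 'k"
  proof -
    have a: "inner (P ** transpose Q) R = inner P (R ** Q)"
      for P :: "real ^ 'n ^ 'm" and Q :: "real ^ 'n ^ 'k" and R :: "real ^ 'k ^ 'm"
      by (metis inner_matrix_mult_adjoint(1) inner_commute)
    have b: "inner (transpose Q ** P) R = inner P (Q ** R)"
      for P :: "real ^ 'n ^ 'm" and Q :: "real ^ 'k ^ 'm" and R :: "real ^ 'n ^ 'k"
      by (metis inner_matrix_mult_adjoint(2) inner_commute)
    define P where "P = A ** S + W ** B"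
    have "hessian (J X) (W, S) (A, B) =
        (P ** transpose S + E ** transpose B, transpose W ** P + transpose A ** E)"
      by (simp add: hessian_J E_def P_def matrix_add_ldistrib matrix_mul_assoc
          bounded_bilinear.add_left[OF bb] add_ac)
    then have "inner (hessian (J X) (W, S) (A, B)) (C, D) =
        inner P (C ** S) + inner E (C ** B) + (inner P (W ** D) + inner E (A ** D))"
      by (simp add: inner_add_left a b)
    then show ?thesis
      by (simp add: P_def[symmetric] inner_add_right)
  qed
  show "inner (hessian (J X) z u) v = inner u (hessian (J X) z v)"
    unfolding z u v inner_commute[of "(G, H)"] form by (simp add: inner_commute add_ac)
qed

lemma lambda_min_self_adjoint:
  fixes L :: "'a::euclidean_space \<Rightarrow> 'a"
  assumes lin: "linear L" and sym: "\<And>u v. inner (L u) v = inner u (L v)"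
  shows "finite (eigenvalues L)" and "eigenvalues L \<noteq> {}"
    and "lambda_min L \<in> eigenvalues L" and "\<And>l. l \<in> eigenvalues L \<Longrightarrow> lambda_min L \<le> l"
proof -
  show fin: "finite (eigenvalues L)"
  proof -
    have "\<forall>l\<in>eigenvalues L. \<exists>v. v \<noteq> 0 \<and> L v = l *\<^sub>R v"
      by (simp add: eigenvalues_def)
    then obtain e where e: "\<And>l. l \<in> eigenvalues L \<Longrightarrow> e l \<noteq> 0 \<and> L (e l) = l *\<^sub>R e l"
      by metis
    have orth: "inner (e l) (e l') = 0"
      if "l \<in> eigenvalues L" "l' \<in> eigenvalues L" "l \<noteq> l'" for l l'
      using sym[of "e l" "e l'"] e[OF that(1)] e[OF that(2)] that(3) by auto
    have "inj_on e (eigenvalues L)"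
      by (rule inj_onI) (metis orth e inner_eq_zero_iff)
    moreover have "finite (e ` eigenvalues L)"
      by (rule pairwise_orthogonal_imp_finite)
         (auto simp: pairwise_def orthogonal_def intro!: orth)
    ultimately show ?thesis
      by (rule finite_imageD[rotated])
  qed
  show ne: "eigenvalues L \<noteq> {}"
  proof -
    have cont: "continuous_on (sphere 0 1) (\<lambda>v. inner (L v) v)"
      using lin by (intro continuous_intros linear_continuous_on) (simp add: linear_conv_bounded_linear)
    have "sphere (0::'a) 1 \<noteq> {}" by simp
    then obtain v where v: "norm v = 1"
      and vmin: "\<And>w. norm w = 1 \<Longrightarrow> inner (L v) v \<le> inner (L w) w"
      using continuous_attains_inf[OF compact_sphere _ cont] by auto
    define l where "l = inner (L v) v"
    have q: "0 \<le> inner (L w) w - l * inner w w" for w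
    proof (cases "w = 0")
      case False
      have "l \<le> inner (L (w /\<^sub>R norm w)) (w /\<^sub>R norm w)"
        unfolding l_def by (rule vmin) (simp add: False)
      also have "\<dots> = inner (L w) w / inner w w"
        using False by (simp add: linear_scale[OF lin] dot_square_norm power2_eq_square field_simps)
      finally show ?thesis
        using False by (simp add: field_simps)
    qed (simp add: linear_0[OF lin])
    define r where "r = L v - l *\<^sub>R v"
    define c where "c = inner (L r) r - l * inner r r"
    have expand: "0 \<le> 2 * t * inner r r + t\<^sup>2 * c" for t
    proof -
      have vv: "inner v v = 1" using v by (simp add: dot_square_norm)
      have Lr: "inner (L r) v = inner (L v) r" using sym[of r v] by (simp add: inner_commute)
      have rr: "inner r r = inner (L v) r - l * inner v r"
        unfolding r_def by (simp add: inner_diff_left)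
      have "inner (L (v + t *\<^sub>R r)) (v + t *\<^sub>R r) - l * inner (v + t *\<^sub>R r) (v + t *\<^sub>R r)
          = (inner (L v) v - l * inner v v) + 2 * t * (inner (L v) r - l * inner v r) + t\<^sup>2 * c"
        unfolding c_def
        by (simp add: linear_add[OF lin] linear_scale[OF lin] inner_add_left inner_add_right Lr
            inner_commute[of r v] algebra_simps power2_eq_square)
      then show ?thesis
        using q[of "v + t *\<^sub>R r"] rr vv l_def by simp
    qed
    have "r = 0"
    proof (rule ccontr)
      assume "r \<noteq> 0"
      define t where "t = - inner r r / (\<bar>c\<bar> + 1)"
      have rp: "inner r r > 0" using \<open>r \<noteq> 0\<close> by simp
      have t: "t < 0" unfolding t_def using rp by (simp add: divide_neg_pos)
      have "0 \<le> t * (2 * inner r r + t * c)"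
        using expand[of t] by (simp add: power2_eq_square algebra_simps)
      then have "2 * inner r r + t * c \<le> 0"
        using t by (simp add: zero_le_mult_iff)
      moreover have "\<bar>t * c\<bar> \<le> inner r r"
      proof -
        have "\<bar>t * c\<bar> = inner r r * (\<bar>c\<bar> / (\<bar>c\<bar> + 1))"
          unfolding t_def using rp by (simp add: abs_mult)
        also have "\<dots> \<le> inner r r * 1"
          using rp by (intro mult_left_mono) auto
        finally show ?thesis by simp
      qed
      ultimately show False using rp by linarith
    qed
    then have "L v = l *\<^sub>R v" by (simp add: r_def)
    moreover have "v \<noteq> 0" using v by auto
    ultimately show ?thesis by (auto simp: eigenvalues_def)
  qed
  show "lambda_min L \<in> eigenvalues L"
    unfolding lambda_min_def by (rule Min_in[OF fin ne])
  show "\<And>l. l \<in> eigenvalues L \<Longrightarrow> lambda_min L \<le> l"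
    unfolding lambda_min_def by (rule Min_le[OF fin])
qed

end

theory Submission
  imports Defs
begin

text \<open>
  At a critical point in \<open>M0\<close>, let \<open>l\<close> be the least eigenvalue of \<open>W\<^sup>T W = S S\<^sup>T\<close>, with
  eigenvector \<open>q\<close>, and let \<open>s\<close> be the largest singular value of \<open>E = W S - X\<close>. If \<open>s \<le> l\<close> the
  Hessian is positive semidefinite, so a strict saddle has \<open>l < s\<close>. If \<open>E v = - s u\<close> and
  \<open>E\<^sup>T u = - s v\<close>, then \<open>(u q\<^sup>T, q v\<^sup>T)\<close> is an eigenvector of the Hessian with
  eigenvalue \<open>l - s\<close>. The critical point equations make \<open>s\<close>, and \<open>l\<close> when it is nonzero,
  singular values of \<open>X\<close>; hence \<open>l - s\<close> takes only finitely many values.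
\<close>

section \<open>Extremal eigenvalues and singular values\<close>

text \<open>The Rayleigh quotient attains its minimum on the compact unit sphere, and
  self-adjointness makes the minimizer an eigenvector.\<close>

lemma self_adjoint_min_eigenpair:
  fixes L :: "'a::euclidean_space \<Rightarrow> 'a"
  assumes lin: "linear L" and sym: "\<And>u v. inner (L u) v = inner u (L v)"
  obtains l v where "v \<noteq> 0" "L v = l *\<^sub>R v" "\<And>w. l * (norm w)\<^sup>2 \<le> inner (L w) w"
proof -
  have bl: "bounded_linear L"
    using lin by (simp add: linear_conv_bounded_linear)
  have cont: "continuous_on (sphere 0 1) (\<lambda>v. inner (L v) v)"
    using lin by (intro continuous_intros linear_continuous_on bl)
  have "sphere (0::'a) 1 \<noteq> {}" by simp
  then obtain v where v: "norm v = 1"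
    and vmin: "\<And>w. norm w = 1 \<Longrightarrow> inner (L v) v \<le> inner (L w) w"
    using continuous_attains_inf[OF compact_sphere _ cont] by auto
  define l where "l = inner (L v) v"
  have q: "l * (norm w)\<^sup>2 \<le> inner (L w) w" for w
  proof (cases "w = 0")
    case False
    have "l \<le> inner (L (w /\<^sub>R norm w)) (w /\<^sub>R norm w)"
      unfolding l_def by (rule vmin) (simp add: False)
    also have "\<dots> = inner (L w) w / (norm w)\<^sup>2"
      using False by (simp add: linear_scale[OF lin] power2_eq_square field_simps)
    finally show ?thesis
      using False by (simp add: field_simps)
  qed (simp add: linear_0[OF lin])
  \<comment> \<open>By homogeneity \<open>f\<close> is nonnegative on the whole space and vanishes
    at \<open>v\<close>, so its derivative at \<open>v\<close> is zero; no multiplier for the sphere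
    constraint is involved.\<close>
  define f where "f = (\<lambda>w. inner (L w) w - l * inner w w)"
  have deriv: "(f has_derivative (\<lambda>h. 2 * inner (L v - l *\<^sub>R v) h)) (at v)"
    unfolding f_def
    by (rule derivative_eq_intros bounded_linear.has_derivative[OF bl] refl)+
       (simp add: fun_eq_iff sym[of v] inner_diff_left inner_commute[of _ "L v"] inner_commute[of _ v])
  have "f v = 0" "\<And>w. 0 \<le> f w"
    using q v by (auto simp: f_def l_def power2_norm_eq_inner[symmetric])
  then have "(\<lambda>h. 2 * inner (L v - l *\<^sub>R v) h) = (\<lambda>h. 0)"
    by (intro differential_zero_maxmin[OF _ open_UNIV deriv]) auto
  then have "2 * inner (L v - l *\<^sub>R v) (L v - l *\<^sub>R v) = 0"
    by meson
  then have "L v = l *\<^sub>R v" by simp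
  moreover have "v \<noteq> 0" using v by auto
  ultimately show thesis using that q by blast
qed

lemma inner_gram:
  fixes A :: "real ^ 'b ^ 'a"
  shows "inner ((transpose A ** A) *v x) y = inner (A *v x) (A *v y)"
  by (simp add: dot_lmul_matrix matrix_vector_mul_assoc[symmetric])

lemma gram_self_adjoint:
  fixes A :: "real ^ 'b ^ 'a"
  shows "inner ((transpose A ** A) *v x) y = inner x ((transpose A ** A) *v y)"
  by (metis inner_gram inner_commute)

lemma min_gram_eigenpair:
  fixes A :: "real ^ 'b ^ 'a"
  obtains l q where "0 \<le> l" "q \<noteq> 0" "(transpose A ** A) *v q = l *\<^sub>R q"
    "\<And>x. l * (norm x)\<^sup>2 \<le> (norm (A *v x))\<^sup>2"
proof -
  obtain l q where q: "q \<noteq> 0" "(transpose A ** A) *v q = l *\<^sub>R q"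
    and min: "\<And>x. l * (norm x)\<^sup>2 \<le> inner ((transpose A ** A) *v x) x"
    by (rule self_adjoint_min_eigenpair[of "(*v) (transpose A ** A)"])
       (auto simp: gram_self_adjoint)
  have "l * inner q q = (norm (A *v q))\<^sup>2"
    using inner_gram[of A q q] q by (simp add: power2_norm_eq_inner)
  then have "0 \<le> l"
    by (metis inner_gt_zero_iff q(1) zero_le_mult_iff zero_le_power2 not_less)
  with q min that show thesis
    by (simp add: inner_gram power2_norm_eq_inner)
qed

text \<open>The minimum principle for the negated Gram map yields the largest Gram eigenvalue as
  \<open>- l\<close>, and \<open>s\<close> is its square root.\<close>

lemma max_singular_pair:
  fixes A :: "real ^ 'b ^ 'a"
  obtains s v where "0 \<le> s" "v \<noteq> 0" "(transpose A ** A) *v v = s\<^sup>2 *\<^sub>R v"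
    "\<And>x. (norm (A *v x))\<^sup>2 \<le> s\<^sup>2 * (norm x)\<^sup>2"
proof -
  obtain l v where v: "v \<noteq> 0" "- ((transpose A ** A) *v v) = l *\<^sub>R v"
    and min: "\<And>x. l * (norm x)\<^sup>2 \<le> inner (- ((transpose A ** A) *v x)) x"
    by (rule self_adjoint_min_eigenpair[of "\<lambda>x. - ((transpose A ** A) *v x)"])
       (auto simp: gram_self_adjoint intro!: linear_compose_neg)
  have "(- l) * inner v v = (norm (A *v v))\<^sup>2"
    using inner_gram[of A v v] arg_cong[OF v(2), of "\<lambda>x. inner x v"]
    by (simp add: power2_norm_eq_inner)
  then have "0 \<le> - l"
    by (metis inner_gt_zero_iff v(1) zero_le_mult_iff zero_le_power2 not_less)
  moreover have "(transpose A ** A) *v v = (- l) *\<^sub>R v"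
    using v(2) by (metis minus_equation_iff scaleR_minus_left)
  moreover have "(norm (A *v x))\<^sup>2 \<le> (- l) * (norm x)\<^sup>2" for x
    using min[of x] by (simp add: inner_gram power2_norm_eq_inner)
  ultimately show thesis
    using that[of "sqrt (- l)" v] v(1) by simp
qed

section \<open>Frobenius norms of products\<close>

lemma norm_matrix_columns:
  fixes B :: "real ^ 'c ^ 'b"
  shows "(norm B)\<^sup>2 = (\<Sum>j\<in>UNIV. (norm (column j B))\<^sup>2)"
proof -
  have "(norm B)\<^sup>2 = (\<Sum>i\<in>UNIV. \<Sum>j\<in>UNIV. B $ i $ j * B $ i $ j)"
    by (simp add: power2_norm_eq_inner inner_vec_def)
  also have "\<dots> = (\<Sum>j\<in>UNIV. \<Sum>i\<in>UNIV. B $ i $ j * B $ i $ j)"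
    by (rule sum.swap)
  finally show ?thesis
    by (simp add: power2_norm_eq_inner inner_vec_def column_def)
qed

lemma column_matrix_mult:
  fixes A :: "real ^ 'b ^ 'a" and B :: "real ^ 'c ^ 'b"
  shows "column j (A ** B) = A *v column j B"
  by (simp add: column_def matrix_matrix_mult_def matrix_vector_mult_def vec_eq_iff)

text \<open>\<open>A\<close> acts on each column of \<open>B\<close> separately and the squared
  Frobenius norm adds up over columns, so a bound on vectors passes to matrices.\<close>

lemma norm_matrix_mult_le:
  fixes A :: "real ^ 'b ^ 'a" and B :: "real ^ 'c ^ 'b"
  assumes "\<And>x. (norm (A *v x))\<^sup>2 \<le> c * (norm x)\<^sup>2"
  shows "(norm (A ** B))\<^sup>2 \<le> c * (norm B)\<^sup>2"
  unfolding norm_matrix_columns column_matrix_mult sum_distrib_left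
  by (intro sum_mono assms)

lemma norm_matrix_mult_ge:
  fixes A :: "real ^ 'b ^ 'a" and B :: "real ^ 'c ^ 'b"
  assumes "\<And>x. c * (norm x)\<^sup>2 \<le> (norm (A *v x))\<^sup>2"
  shows "c * (norm B)\<^sup>2 \<le> (norm (A ** B))\<^sup>2"
  unfolding norm_matrix_columns column_matrix_mult sum_distrib_left
  by (intro sum_mono assms)

lemma transpose_0: "transpose (0 :: real ^ 'b ^ 'a) = 0"
  by (simp add: transpose_def vec_eq_iff)

lemma norm_transpose:
  fixes A :: "real ^ 'b ^ 'a"
  shows "norm (transpose A) = norm A"
proof -
  have "(norm (transpose A))\<^sup>2 = (norm A)\<^sup>2"
    unfolding power2_norm_eq_inner inner_matrix_eq_trace
    by (metis trace_mul_sym transpose_transpose)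
  then show ?thesis by simp
qed

section \<open>The quadratic form of the Hessian\<close>

text \<open>This is the second derivative of \<open>J X\<close> along the line through
  \<open>(W, S)\<close> in direction \<open>(G, H)\<close>: the square comes from the first-order
  change of \<open>W ** S\<close>, the other term from pairing its second-order change with the
  residual.\<close>

lemma inner_hessian_J:
  fixes X :: "real ^ 'n ^ 'm" and W G :: "real ^ 'k ^ 'm" and S H :: "real ^ 'n ^ 'k"
  shows "inner (hessian (J X) (W, S) (G, H)) (G, H) =
    (norm (G ** S + W ** H))\<^sup>2 + 2 * inner (W ** S - X) (G ** H)"
proof -
  define E where "E = W ** S - X"
  have "inner (E ** transpose H) G = inner E (G ** H)"
    by (metis inner_matrix_mult_adjoint(1) inner_commute)
  moreover have "inner (transpose G ** E) H = inner E (G ** H)"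
    by (metis inner_matrix_mult_adjoint(2) inner_commute)
  moreover have "inner (P ** transpose S) G = inner P (G ** S)" for P
    by (metis inner_matrix_mult_adjoint(1) inner_commute)
  moreover have "inner (transpose W ** P) H = inner P (W ** H)" for P
    by (metis inner_matrix_mult_adjoint(2) inner_commute)
  moreover define P where "P = G ** S + W ** H"
  have "hessian (J X) (W, S) (G, H) =
      (P ** transpose S + E ** transpose H, transpose W ** P + transpose G ** E)"
    by (simp add: hessian_J E_def P_def matrix_add_ldistrib matrix_mul_assoc
        bounded_bilinear.add_left[OF bounded_bilinear_matrix_mult] add_ac)
  moreover have "(norm P)\<^sup>2 = inner P (G ** S) + inner P (W ** H)"
    unfolding power2_norm_eq_inner by (simp add: P_def inner_add_right)
  ultimately show ?thesis
    by (simp add: E_def[symmetric] P_def[symmetric] inner_add_left)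
qed

text \<open>Modulo the column space of \<open>W\<close> and the row space of \<open>S\<close>, the
  square is at least \<open>l\<close> times the squared norms of the remaining parts, while the
  indefinite term is at most \<open>2 * s\<close> times the product of their norms; with
  \<open>s \<le> l\<close> the square dominates.\<close>

lemma hessian_J_psd:
  fixes X :: "real ^ 'n ^ 'm" and W G :: "real ^ 'k ^ 'm" and S H :: "real ^ 'n ^ 'k"
  defines "E \<equiv> W ** S - X"
  assumes crit: "E ** transpose S = 0" "transpose W ** E = 0"
    and bal: "transpose W ** W = S ** transpose S"
    and low: "\<And>x. l * (norm x)\<^sup>2 \<le> (norm (W *v x))\<^sup>2"
    and up: "\<And>x. (norm (E *v x))\<^sup>2 \<le> s\<^sup>2 * (norm x)\<^sup>2"
    and s: "0 \<le> s" "s \<le> l"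
  shows "0 \<le> inner (hessian (J X) (W, S) (G, H)) (G, H)"
proof (cases "s = 0")
  case True
  \<comment> \<open>Here \<open>l\<close> may vanish, so the inverse of
    \<open>transpose W ** W\<close> taken in the other case need not exist; but \<open>E = 0\<close>
    leaves only the square.\<close>
  have "(norm (E ** mat 1))\<^sup>2 \<le> s\<^sup>2 * (norm (mat 1 :: real ^ 'n ^ 'n))\<^sup>2"
    by (rule norm_matrix_mult_le[OF up])
  then have "E = 0"
    using True by simp
  then show ?thesis
    by (simp add: inner_hessian_J E_def[symmetric])
next
  case False
  then have "0 < l" using s by simp
  have "x = 0" if "(transpose W ** W) *v x = 0" for x
  proof -
    have "(norm (W *v x))\<^sup>2 = 0"
      using that inner_gram[of W x x] by (simp add: power2_norm_eq_inner)
    then show "x = 0"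
      using low[of x] \<open>0 < l\<close> by (simp add: mult_le_0_iff)
  qed
  then obtain C where C: "C ** (transpose W ** W) = mat 1"
    using matrix_left_invertible_ker by blast
  then have C': "(transpose W ** W) ** C = mat 1"
    by (simp add: matrix_left_right_inverse)
  \<comment> \<open>Split off the parts of \<open>G\<close> and \<open>H\<close> in the column space of \<open>W\<close> and the row space of \<open>S\<close>:
    \<open>inner E (G ** H)\<close> does not see them, and \<open>P\<close>, \<open>Q\<close>, \<open>R\<close> below are orthogonal.\<close>
  define A where "A = C ** transpose W ** G"
  define B where "B = H ** transpose S ** C"
  define G' where "G' = G - W ** A"
  define H' where "H' = H - B ** S"
  note bb = bounded_bilinear_matrix_mult
  note bil = bounded_bilinear.add_left[OF bb] bounded_bilinear.add_right[OF bb]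
    bounded_bilinear.diff_left[OF bb] bounded_bilinear.diff_right[OF bb]
  have G'0: "transpose W ** G' = 0"
  proof -
    have "transpose W ** (W ** A) = (transpose W ** W) ** C ** transpose W ** G"
      by (simp add: A_def matrix_mul_assoc)
    then show ?thesis by (simp add: C' G'_def bil)
  qed
  have H'0: "H' ** transpose S = 0"
  proof -
    have "B ** S ** transpose S = H ** transpose S ** (C ** (S ** transpose S))"
      by (simp add: B_def matrix_mul_assoc)
    then show ?thesis by (simp add: C bal[symmetric] H'_def bil)
  qed
  define P where "P = G' ** S"
  define Q where "Q = W ** H'"
  define R where "R = W ** (A + B) ** S"
  have eq: "G ** S + W ** H = P + Q + R"
    by (simp add: P_def Q_def R_def G'_def H'_def bil matrix_mul_assoc)
  have WX: "inner (W ** M) (G' ** N) = 0" for M :: "real ^ 'n ^ 'k" and N :: "real ^ 'n ^ 'k"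
    by (simp add: inner_matrix_mult_adjoint(2)[of W] matrix_mul_assoc G'0)
  have XS: "inner (M ** S) (N ** H') = 0" for M :: "real ^ 'k ^ 'm" and N :: "real ^ 'k ^ 'm"
  proof -
    have "inner (N ** H') (M ** S) = inner N (M ** (S ** transpose H'))"
      by (simp add: inner_matrix_mult_adjoint(1)[of N] matrix_mul_assoc)
    also have "S ** transpose H' = transpose (H' ** transpose S)"
      by (simp add: matrix_transpose_mul)
    finally show ?thesis
      by (simp add: H'0 transpose_0 inner_commute)
  qed
  have orth: "inner P Q = 0" "inner P R = 0" "inner Q R = 0"
    using WX[of H' S] WX[of "(A + B) ** S" S] XS[of "W ** (A + B)" W]
    by (simp_all add: P_def Q_def R_def matrix_mul_assoc inner_commute)
  have "(norm (P + Q + R))\<^sup>2 = (norm P)\<^sup>2 + (norm Q)\<^sup>2 + (norm R)\<^sup>2"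
    unfolding power2_norm_eq_inner using orth
    by (simp add: inner_add_left inner_add_right inner_commute)
  then have sq: "(norm P)\<^sup>2 + (norm Q)\<^sup>2 \<le> (norm (G ** S + W ** H))\<^sup>2"
    by (simp add: eq)
  \<comment> \<open>Balance trades \<open>S ** transpose S\<close> for
    \<open>transpose W ** W\<close>, so the lower bound on \<open>W\<close> also controls right
    multiplication by \<open>S\<close>.\<close>
  have "(norm P)\<^sup>2 = inner G' (G' ** (S ** transpose S))"
    by (simp add: P_def power2_norm_eq_inner inner_matrix_mult_adjoint(1)[of G'] matrix_mul_assoc)
  also have "\<dots> = (norm (G' ** transpose W))\<^sup>2"
    by (simp add: bal[symmetric] power2_norm_eq_inner inner_matrix_mult_adjoint(1)[of G'] matrix_mul_assoc)
  also have "\<dots> = (norm (W ** transpose G'))\<^sup>2"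
    by (metis norm_transpose matrix_transpose_mul transpose_transpose)
  finally have P: "l * (norm G')\<^sup>2 \<le> (norm P)\<^sup>2"
    using norm_matrix_mult_ge[OF low, of "transpose G'"] by (simp add: norm_transpose)
  have Q: "l * (norm H')\<^sup>2 \<le> (norm Q)\<^sup>2"
    unfolding Q_def by (rule norm_matrix_mult_ge[OF low])
  have "inner E (W ** M) = 0" for M :: "real ^ 'n ^ 'k"
    by (simp add: inner_commute[of E] inner_matrix_mult_adjoint(2)[of W] crit)
  moreover have "inner E (M ** S) = 0" for M :: "real ^ 'k ^ 'm"
    by (simp add: inner_commute[of E] inner_matrix_mult_adjoint(1)[of M] crit)
  moreover have "G ** H = G' ** H' + W ** (A ** H) + (G' ** B) ** S"
    by (simp add: G'_def H'_def bil matrix_mul_assoc)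
  ultimately have "inner E (G ** H) = inner E (G' ** H')"
    by (simp add: inner_add_right)
  also have "\<dots> = inner (E ** transpose H') G'"
    by (metis inner_matrix_mult_adjoint(1) inner_commute)
  finally have "\<bar>inner E (G ** H)\<bar> \<le> norm (E ** transpose H') * norm G'"
    by (simp add: Cauchy_Schwarz_ineq2)
  also have "norm (E ** transpose H') \<le> s * norm H'"
    using norm_matrix_mult_le[OF up, of "transpose H'"] s
    by - (rule power2_le_imp_le, simp_all add: norm_transpose power_mult_distrib)
  finally have "\<bar>inner E (G ** H)\<bar> \<le> s * norm H' * norm G'"
    by (simp add: mult_right_mono)
  also have "\<dots> \<le> l * norm H' * norm G'"
    using s by (intro mult_right_mono) auto
  finally have "2 * \<bar>inner E (G ** H)\<bar> \<le> l * (2 * norm G' * norm H')"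
    by (simp add: algebra_simps)
  also have "\<dots> \<le> l * ((norm G')\<^sup>2 + (norm H')\<^sup>2)"
    using \<open>0 < l\<close> by (intro mult_left_mono sum_squares_bound) auto
  also have "\<dots> \<le> (norm (G ** S + W ** H))\<^sup>2"
    using P Q sq by (simp add: algebra_simps)
  finally show ?thesis
    by (simp add: inner_hessian_J E_def[symmetric])
qed

section \<open>Rank-one directions of negative curvature\<close>

definition outer :: "real ^ 'a \<Rightarrow> real ^ 'b \<Rightarrow> real ^ 'b ^ 'a"
  where "outer u v = (\<chi> i j. u $ i * v $ j)"

lemma outer_simps:
  "A ** outer u v = outer (A *v u) v"
  "outer u v ** B = outer u (transpose B *v v)"
  "transpose (outer u v) = outer v u"
  "outer (c *\<^sub>R u) v = c *\<^sub>R outer u v"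
  "outer u (c *\<^sub>R v) = c *\<^sub>R outer u v"
  "outer 0 v = 0" "outer u 0 = 0"
  by (simp_all add: outer_def matrix_matrix_mult_def matrix_vector_mult_def transpose_def vec_eq_iff
      sum_distrib_left sum_distrib_right mult_ac)

lemma outer_eq_0_iff: "outer u v = 0 \<longleftrightarrow> u = 0 \<or> v = 0"
  by (auto simp: outer_def vec_eq_iff)

lemma finite_negative_gap:
  assumes "finite (D :: real set)"
  obtains \<gamma> where "\<gamma> < 0" "\<And>d. d \<in> D \<Longrightarrow> d < 0 \<Longrightarrow> d < \<gamma>"
proof -
  \<comment> \<open>The element \<open>-1\<close> keeps \<open>N\<close> nonempty when
    \<open>D\<close> has no negative element; halving the negative maximum below makes the bound
    strict.\<close>
  define N where "N = insert (-1) {d \<in> D. d < 0}"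
  have fin: "finite N" using assms by (simp add: N_def)
  have "Max N \<in> N" by (rule Max_in[OF fin]) (simp add: N_def)
  then have "Max N < 0" by (auto simp: N_def)
  moreover have "d < Max N / 2" if "d \<in> D" "d < 0" for d
    using Max_ge[OF fin, of d] that \<open>Max N < 0\<close> by (simp add: N_def)
  ultimately show thesis using that[of "Max N / 2"] by simp
qed

text \<open>Expresses a negative Hessian eigenvalue through spectral data of \<open>X\<close> alone,
  which is what permits a bound independent of \<open>(W, S)\<close>. In the proof,
  \<open>l = 0\<close> means that \<open>W\<close> has a nontrivial kernel.\<close>

lemma strict_saddle_hessian_eigenvalue:
  fixes X :: "real ^ 'n ^ 'm" and W :: "real ^ 'k ^ 'm" and S :: "real ^ 'n ^ 'k"
  assumes saddle: "strict_saddle (J X) (W, S)" and "(W, S) \<in> M0"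
  obtains l s where "0 \<le> l" "l < s" "l - s \<in> eigenvalues (hessian (J X) (W, S))"
    "s\<^sup>2 \<in> eigenvalues ((*v) (transpose X ** X))"
    "l = 0 \<or> l\<^sup>2 \<in> eigenvalues ((*v) (transpose X ** X))"
proof -
  define E where "E = W ** S - X"
  have crit: "E ** transpose S = 0" "transpose W ** E = 0"
    using saddle by (simp_all add: strict_saddle_def gradient_J E_def zero_prod_def)
  have bal: "transpose W ** W = S ** transpose S"
    using assms(2) by (simp add: M0_def)
  obtain l q where l: "0 \<le> l" "q \<noteq> 0" "(transpose W ** W) *v q = l *\<^sub>R q"
    and low: "\<And>x. l * (norm x)\<^sup>2 \<le> (norm (W *v x))\<^sup>2"
    by (rule min_gram_eigenpair[of W]) blast
  obtain s v where s: "0 \<le> s" "v \<noteq> 0" "(transpose E ** E) *v v = s\<^sup>2 *\<^sub>R v"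
    and up: "\<And>x. (norm (E *v x))\<^sup>2 \<le> s\<^sup>2 * (norm x)\<^sup>2"
    by (rule max_singular_pair[of E]) blast
  have "l < s"
  proof (rule ccontr)
    assume "\<not> l < s"
    then have psd: "0 \<le> inner (hessian (J X) (W, S) z) z" for z
      using hessian_J_psd[of W S X l s "fst z" "snd z"] crit bal low up s(1)
      by (simp add: E_def)
    have "lambda_min (hessian (J X) (W, S)) \<in> eigenvalues (hessian (J X) (W, S))"
      by (rule lambda_min_self_adjoint(3)[OF hessian_J_self_adjoint])
    then obtain z where "z \<noteq> 0"
      "hessian (J X) (W, S) z = lambda_min (hessian (J X) (W, S)) *\<^sub>R z"
      by (auto simp: eigenvalues_def)
    then have "0 \<le> lambda_min (hessian (J X) (W, S)) * inner z z" "0 < inner z z"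
      using psd[of z] by simp_all
    then have "0 \<le> lambda_min (hessian (J X) (W, S))"
      by (meson not_less zero_le_mult_iff)
    then show False using saddle by (simp add: strict_saddle_def)
  qed
  then have "0 < s" using l(1) by simp
  \<comment> \<open>The sign makes \<open>(u, v)\<close> a singular pair of \<open>- E\<close>, the
    part of \<open>X\<close> left once \<open>W ** S\<close> drops out, and gives the off-diagonal
    Hessian terms the factor \<open>- s\<close>.\<close>
  define u where "u = (- 1 / s) *\<^sub>R (E *v v)"
  have Ev: "E *v v = (- s) *\<^sub>R u"
    using \<open>0 < s\<close> by (simp add: u_def)
  have mult_u: "A *v u = (- 1 / s) *\<^sub>R ((A ** E) *v v)" for A :: "real ^ 'm ^ 'x"
    by (simp only: u_def matrix_vector_mult_scaleR matrix_vector_mul_assoc)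
  have Eu: "transpose E *v u = (- s) *\<^sub>R v"
    using \<open>0 < s\<close> by (simp add: mult_u s(3) power2_eq_square del: transpose_matrix_vector)
  \<comment> \<open>Since \<open>s\<close> is positive, \<open>u\<close> lies in the range of
    \<open>E\<close> and \<open>v\<close> in that of \<open>transpose E\<close>; the critical point
    equations then annihilate both.\<close>
  have Wu: "transpose W *v u = 0"
    by (simp add: mult_u crit del: transpose_matrix_vector)
  have "S ** transpose E = 0"
    by (metis crit(1) matrix_transpose_mul transpose_transpose transpose_0)
  then have "(- s) *\<^sub>R (S *v v) = 0"
    by (metis Eu matrix_vector_mult_scaleR matrix_vector_mul_assoc matrix_vector_mult_0)
  then have Sv: "S *v v = 0"
    using \<open>0 < s\<close> by simp
  have X: "X = W ** S - E" by (simp add: E_def)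
  have XE: "X *v x = W *v (S *v x) - E *v x"
    "transpose X *v y = transpose S *v (transpose W *v y) - transpose E *v y" for x y
    unfolding X
    by (simp_all add: linear_diff[OF bounded_linear.linear[OF bounded_linear_transpose]]
        matrix_transpose_mul matrix_vector_mult_diff_rdistrib matrix_vector_mul_assoc
        del: transpose_matrix_vector)
  show thesis
  proof
    show "0 \<le> l" "l < s" by fact+
    show "l - s \<in> eigenvalues (hessian (J X) (W, S))"
    proof -
      \<comment> \<open>By balance the same \<open>q\<close> is an eigenvector for both diagonal
        blocks, so both contribute the factor \<open>l\<close>.\<close>
      have gram: "outer u q ** S ** transpose S = l *\<^sub>R outer u q"
        "transpose W ** W ** outer q v = l *\<^sub>R outer q v"
        using l(3) unfolding bal
        by (simp_all only: matrix_mul_assoc[symmetric] outer_simps matrix_transpose_mul transpose_transpose)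
           (simp_all only: matrix_vector_mul_assoc bal outer_simps)
      have cross: "W ** outer q v ** transpose S = 0" "transpose W ** outer u q ** S = 0"
        by (simp_all add: outer_simps Sv Wu del: transpose_matrix_vector)
      have off: "E ** transpose (outer q v) = (- s) *\<^sub>R outer u q"
        "transpose (outer u q) ** E = (- s) *\<^sub>R outer q v"
        by (simp_all only: outer_simps Ev Eu)
      have "hessian (J X) (W, S) (outer u q, outer q v) = (l - s) *\<^sub>R (outer u q, outer q v)"
        by (simp only: hessian_J E_def[symmetric] gram cross off) (simp add: algebra_simps)
      moreover have "(outer u q, outer q v) \<noteq> 0"
        using l(2) s(2) by (simp add: zero_prod_def outer_eq_0_iff)
      ultimately show ?thesis
        unfolding eigenvalues_def by blast
    qed
    have "X *v v = s *\<^sub>R u" "transpose X *v u = s *\<^sub>R v"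
      by (simp_all add: XE Sv Wu Ev Eu del: transpose_matrix_vector)
    then have "(transpose X ** X) *v v = s\<^sup>2 *\<^sub>R v"
      by (simp add: matrix_vector_mul_assoc[symmetric] matrix_vector_mult_scaleR power2_eq_square
          del: transpose_matrix_vector)
    then show "s\<^sup>2 \<in> eigenvalues ((*v) (transpose X ** X))"
      using s(2) unfolding eigenvalues_def by blast
    show "l = 0 \<or> l\<^sup>2 \<in> eigenvalues ((*v) (transpose X ** X))"
    proof (cases "l = 0")
      case False
      \<comment> \<open>\<open>p\<close> and \<open>W *v q\<close> are unnormalized right and left
        singular vectors of \<open>X\<close> for the value \<open>l\<close>: \<open>E\<close>
        annihilates \<open>p\<close> and \<open>transpose E\<close> annihilates
        \<open>W *v q\<close>. A nonzero \<open>l\<close> ensures that \<open>p\<close> is nonzero,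
        as \<open>S *v p = l *\<^sub>R q\<close>.\<close>
      define p where "p = transpose S *v q"
      have Sp: "S *v p = l *\<^sub>R q"
        using l(3) by (simp add: p_def bal matrix_vector_mul_assoc del: transpose_matrix_vector)
      have "E *v p = 0"
        by (simp add: p_def matrix_vector_mul_assoc crit del: transpose_matrix_vector)
      then have Xp: "X *v p = l *\<^sub>R (W *v q)"
        by (simp add: XE Sp matrix_vector_mult_scaleR)
      have "transpose E ** W = 0"
        by (metis crit(2) matrix_transpose_mul transpose_transpose transpose_0)
      then have "transpose E *v (W *v q) = 0"
        by (simp add: matrix_vector_mul_assoc del: transpose_matrix_vector)
      moreover have "transpose W *v (W *v q) = l *\<^sub>R q"
        using l(3) by (simp add: matrix_vector_mul_assoc del: transpose_matrix_vector)
      ultimately have "transpose X *v (W *v q) = l *\<^sub>R p"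
        by (simp add: XE p_def matrix_vector_mult_scaleR del: transpose_matrix_vector)
      then have "(transpose X ** X) *v p = l\<^sup>2 *\<^sub>R p"
        by (simp add: matrix_vector_mul_assoc[symmetric] Xp matrix_vector_mult_scaleR power2_eq_square
          del: transpose_matrix_vector)
      moreover have "p \<noteq> 0"
        using Sp False l(2) by auto
      ultimately show ?thesis
        unfolding eigenvalues_def by blast
    qed simp
  qed
qed

section \<open>Finitely many gaps and the uniform bound\<close>

theorem corollary4p2:
  fixes X :: "real ^ 'n ^ 'm"
  shows "\<exists>\<gamma><0. \<forall>(W :: real ^ 'k ^ 'm) (S :: real ^ 'n ^ 'k).
    strict_saddle (J X) (W, S) \<and> (W, S) \<in> M0 \<longrightarrow> lambda_min (hessian (J X) (W, S)) < \<gamma>"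
proof -
  define T where "T = eigenvalues ((*v) (transpose X ** X))"
  \<comment> \<open>\<open>F\<close> depends only on \<open>X\<close> and contains every possible
    \<open>l\<close> and \<open>s\<close>; the element \<open>0\<close> covers the case
    \<open>l = 0\<close>.\<close>
  define F where "F = insert 0 (sqrt ` T)"
  have "finite T"
    unfolding T_def
    by (rule lambda_min_self_adjoint(1))
       (auto simp: gram_self_adjoint)
  then have "finite ((\<lambda>(a, b). a - b) ` (F \<times> F))"
    by (simp add: F_def)
  then obtain \<gamma> where "\<gamma> < 0"
    and gap: "\<And>d. d \<in> (\<lambda>(a, b). a - b) ` (F \<times> F) \<Longrightarrow> d < 0 \<Longrightarrow> d < \<gamma>"
    by (rule finite_negative_gap) blast
  have "lambda_min (hessian (J X) (W, S)) < \<gamma>"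
    if saddle: "strict_saddle (J X) (W, S)" and M0: "(W, S) \<in> M0"
    for W :: "real ^ 'k ^ 'm" and S :: "real ^ 'n ^ 'k"
  proof -
    obtain l s where ls: "0 \<le> l" "l < s" and ev: "l - s \<in> eigenvalues (hessian (J X) (W, S))"
      and T: "s\<^sup>2 \<in> T" "l = 0 \<or> l\<^sup>2 \<in> T"
      unfolding T_def by (rule strict_saddle_hessian_eigenvalue[OF saddle M0])
    have "s \<in> F"
      using T(1) ls unfolding F_def by (auto intro!: image_eqI[where x = "s\<^sup>2"])
    moreover have "l \<in> F"
      using T(2) ls unfolding F_def by (auto intro!: image_eqI[where x = "l\<^sup>2"])
    ultimately have "l - s \<in> (\<lambda>(a, b). a - b) ` (F \<times> F)"
      using ls by (auto intro!: image_eqI[where x = "(l, s)"])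
    then have "l - s < \<gamma>"
      using gap ls by simp
    moreover have "lambda_min (hessian (J X) (W, S)) \<le> l - s"
      by (rule lambda_min_self_adjoint(4)[OF hessian_J_self_adjoint ev])
    ultimately show ?thesis by simp
  qed
  with \<open>\<gamma> < 0\<close> show ?thesis by blast
qed

end
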